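(* Consider an evidence-augmented AMM with positive decreasing liquidity function $\beta$, at state $(\boldsymbol{s}_{t-1},R_{t-1})$ with $R_{t-1}=r(E^{total}_{t-1})$. (i) The expected payoff from a trade $(\boldsymbol{z}_t,E_t)$ equals the expected profit from updating an evidence-augmented LMSR from belief $q_{t-1}=\pi(\boldsymbol{s}_{t-1};R_{t-1})$ and liquidity $\beta(R_{t-1})$ to belief $q_t=\pi(\boldsymbol{s}_{t-1}+\boldsymbol{z}_t;\,r(E^{total}_{t-1}\cup E_t))$ and liquidity $\beta(r(E^{total}_{t-1}\cup E_t))$. (ii) For a trader who has true belief $q_t$ and evidence $E_t$, there exists a trade $\boldsymbol{z}_t\in\mathbb{R}^n$ such that $\pi(\boldsymbol{s}_{t-1}+\boldsymbol{z}_t;\,r(E^{total}_{t-1}\cup E_t))=q_t$, and it is $\varepsilon$-incentive compatible for the trader to submit the trade $(\boldsymbol{z}_t,E_t)$ as opposed to any other trade $(\boldsymbol{z}',E'_t)$ with $\boldsymbol{z}'\in\mathbb{R}^n$, $E'_t\subseteq E_t$.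
   Context: There are $n$ alternatives. Evidence quality is a function $r$ on finite evidence sets with $r(E)\ge0$ and $r(E_1)\le r(E_2)$ whenever $E_1\subseteq E_2$; $E^{total}_{t-1}$ is the evidence in the market before trader $t$. $\beta:[0,\infty)\to(0,\infty)$ is positive and decreasing. Beliefs lie in the relative interior of the $(n-1)$-simplex. Evidence-augmented AMM: $\boldsymbol{s}\in\mathbb{R}^n_{\ge0}$ is the vector of shares sold; a share of alternative $i$ pays $1$ if $i$ is the resolution outcome and $0$ otherwise. The cost and price functions are $$C(\boldsymbol{s};R)=\beta(R)\log\sum_i\exp\!\Big(\frac{s_i}{\beta(R)}\Big),\qquad \pi_i(\boldsymbol{s};R)=\frac{\partial C}{\partial s_i}=\frac{\exp(s_i/\beta(R))}{\sum_j\exp(s_j/\beta(R))}.$$ A trader buying (selling) $\boldsymbol{z}\in\mathbb{R}^n$ and supplying evidence $E$ pays $C(\boldsymbol{s}_{t-1}+\boldsymbol{z};r(E^{total}_{t-1}\cup E))-C(\boldsymbol{s}_{t-1};R_{t-1})$; so if the outcome is $i$ the payoff of the trade is $z_i$ minus this amount. Evidence-augmented LMSR: moving the report from $q_{t-1}$ to $q$ while the liquidity goes from $\beta(R_{t-1})$ to $\beta(r(E^{total}_{t-1}\cup E))$ yields profit $\beta(r(E^{total}_{t-1}\cup E))\log q^{\omega}-\beta(R_{t-1})\log q_{t-1}^{\omega}$ when the outcome is $\omega$. In (i) both expectations are taken with respect to the same distribution of the outcome. True belief: under exogenous resolution the trader's true belief $q_t$ does not depend on the evidence submitted. Under endogenous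 resolution it depends on the submitted set $E'_t$ and is $q_t(E'_t)$, with $q_t$ in (ii) meaning $q_t(E_t)$; the payoff of a trade $(\boldsymbol{z}',E'_t)$ is evaluated in expectation under $q_t(E'_t)$. "$\varepsilon$-incentive compatible" means: no other trade has expected payoff exceeding that of $(\boldsymbol{z}_t,E_t)$ by more than $\varepsilon$, where under exogenous resolution $\varepsilon=0$, and under endogenous resolution this holds for any prescribed $\varepsilon>0$ with a suitable choice of the resolution temperature $\tau$. Endogenous resolution: each piece of evidence $e$ has outcomes $X_{ie}\in\{0,1\}$. Once exactly $K$ pieces have accumulated, with $\theta_i=\frac1K\sum_eX_{ie}$, the market resolves to $j$ with probability $\exp(\theta_j/\tau)/\sum_\ell\exp(\theta_\ell/\tau)$. When trader $t$ arrives there are $k(t)$ pieces, $k_j(t)$ of which support $j$ (i.e. have $X_{je}=1$), and $k(t)+|E_t|\le K$. If $E'_t$ is submitted, with $|E'_{t,j}|$ of its pieces supporting $j$, then $K-k(t)-|E'_t|$ further pieces arrive; the trader has a distribution, not depending on what they submit, over the sequence of outcome vectors of future pieces, and $S_j$ counts those supporting $j$ among the first $K-k(t)-|E'_t|$. With $\theta_{tj}(E'_t)=\frac{k_j(t)+|E'_{t,j}|+S_j}{K}$, $q_{tj}(E'_t)=\mathbb{E}\big[\exp(\theta_{tj}(E'_t)/\tau)/\sum_\ell\exp(\theta_{t\ell}(E'_t)/\tau)\big]$. Earlier traders act truthfully, so in the endogenous case the current market belief $q_{t-1}=\pi(\boldsymbol{s}_{t-1};R_{t-1})$ is a mixture of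 vectors $\mathrm{softmax}(\theta;\tau)$, $\theta\in[0,1]^n$, at the same temperature $\tau$. *)

theory Defs
  imports "HOL-Probability.Probability"
begin

definition prob_simplex :: "(real ^ 'n) set" where
  "prob_simplex = {q. (\<forall>i. 0 \<le> q $ i) \<and> (\<Sum>i\<in>UNIV. q $ i) = 1}"

lemma rel_interior_prob_simplex:
  "rel_interior (prob_simplex :: (real ^ 'n) set)
     = {q. (\<forall>i. 0 < q $ i) \<and> (\<Sum>i\<in>UNIV. q $ i) = 1}"
proof -
  have inj: "inj (\<lambda>i::'n. axis i (1::real))"
    by (auto simp: inj_on_def axis_eq_axis)
  have B: "(Basis :: (real ^ 'n) set) = range (\<lambda>i. axis i 1)"
    by (auto simp: Basis_vec_def)
  have expand: "(\<Sum>x\<in>Basis. u x *\<^sub>R x) = (\<chi> i. u (axis i 1))" for u :: "real ^ 'n \<Rightarrow> real"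
    unfolding B sum.reindex[OF inj]
    by (simp add: vec_eq_iff axis_def if_distrib [where f="\<lambda>x. _ * x"] cong: if_cong)
  have total: "sum u Basis = (\<Sum>i\<in>UNIV. u (axis i 1))" for u :: "real ^ 'n \<Rightarrow> real"
    unfolding B sum.reindex[OF inj] by simp
  have lift: "\<exists>u :: real ^ 'n \<Rightarrow> real. \<forall>i. u (axis i 1) = q $ i" for q :: "real ^ 'n"
    by (rule exI[of _ "\<lambda>x. q \<bullet> x"]) (simp add: inner_axis)
  have hull: "(prob_simplex :: (real ^ 'n) set) = convex hull Basis"
  proof -
    have "q \<in> convex hull Basis \<longleftrightarrow> q \<in> prob_simplex" for q :: "real ^ 'n"
    proof
      assume "q \<in> convex hull Basis"
      then obtain u where "\<forall>x\<in>Basis. 0 \<le> u x" "sum u Basis = 1" "(\<Sum>x\<in>Basis. u x *\<^sub>R x) = q"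
        by (auto simp: convex_hull_finite)
      then show "q \<in> prob_simplex"
        unfolding expand total by (auto simp: prob_simplex_def B)
    next
      assume q: "q \<in> prob_simplex"
      obtain u :: "real ^ 'n \<Rightarrow> real" where "\<forall>i. u (axis i 1) = q $ i" using lift by blast
      then have "(\<forall>x\<in>Basis. 0 \<le> u x) \<and> sum u Basis = 1 \<and> (\<Sum>x\<in>Basis. u x *\<^sub>R x) = q"
        using q unfolding expand total by (auto simp: prob_simplex_def B)
      then show "q \<in> convex hull Basis"
        by (auto simp: convex_hull_finite)
    qed
    then show ?thesis by blast
  qed
  have indep: "\<not> affine_dependent (Basis :: (real ^ 'n) set)"
    using affine_dependent_imp_dependent independent_Basis by blast
  have "q \<in> rel_interior prob_simplex \<longleftrightarrow> (\<forall>i. 0 < q $ i) \<and> (\<Sum>i\<in>UNIV. q $ i) = 1"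
    for q :: "real ^ 'n"
  proof
    assume "q \<in> rel_interior prob_simplex"
    then show "(\<forall>i. 0 < q $ i) \<and> (\<Sum>i\<in>UNIV. q $ i) = 1"
      unfolding hull rel_interior_convex_hull_explicit[OF indep] expand total by (auto simp: B)
  next
    assume q: "(\<forall>i. 0 < q $ i) \<and> (\<Sum>i\<in>UNIV. q $ i) = 1"
    obtain u :: "real ^ 'n \<Rightarrow> real" where "\<forall>i. u (axis i 1) = q $ i" using lift by blast
    then have "(\<forall>x\<in>Basis. 0 < u x) \<and> sum u Basis = 1 \<and> (\<Sum>x\<in>Basis. u x *\<^sub>R x) = q"
      using q unfolding expand total by (auto simp: B)
    then show "q \<in> rel_interior prob_simplex"
      unfolding hull rel_interior_convex_hull_explicit[OF indep] by blast
  qed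
  then show ?thesis by blast
qed

definition evidence_quality :: "('e set \<Rightarrow> real) \<Rightarrow> bool" where
  "evidence_quality r \<longleftrightarrow>
     (\<forall>E. finite E \<longrightarrow> 0 \<le> r E) \<and>
     (\<forall>E1 E2. finite E2 \<longrightarrow> E1 \<subseteq> E2 \<longrightarrow> r E1 \<le> r E2)"

text \<open>Liquidity functions are defined on \<open>[0,\<infinity>)\<close>; their values at negative arguments are never used.\<close>

definition liquidity :: "(real \<Rightarrow> real) \<Rightarrow> bool" where
  "liquidity \<beta> \<longleftrightarrow> (\<forall>R\<ge>0. 0 < \<beta> R) \<and> antimono_on {0..} \<beta>"

definition softmax :: "real \<Rightarrow> real ^ 'n \<Rightarrow> real ^ 'n" where
  "softmax \<tau> x = (\<chi> i. exp (x $ i / \<tau>) / (\<Sum>j\<in>UNIV. exp (x $ j / \<tau>)))"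

definition cost :: "(real \<Rightarrow> real) \<Rightarrow> real ^ 'n \<Rightarrow> real \<Rightarrow> real" where
  "cost \<beta> s R = \<beta> R * ln (\<Sum>i\<in>UNIV. exp (s $ i / \<beta> R))"

definition price :: "(real \<Rightarrow> real) \<Rightarrow> real ^ 'n \<Rightarrow> real \<Rightarrow> real ^ 'n" where
  "price \<beta> s R = softmax (\<beta> R) s"

lemma price_partial_derivative:
  fixes s :: "real ^ 'n"
  assumes "0 < \<beta> R"
  shows "((\<lambda>h. cost \<beta> (s + h *\<^sub>R axis i 1) R) has_real_derivative price \<beta> s R $ i) (at 0)"
proof -
  have pos: "0 < (\<Sum>j\<in>UNIV. exp (s $ j / \<beta> R))"
    by (intro sum_pos) auto
  have "((\<lambda>h. \<beta> R * ln (\<Sum>j\<in>UNIV. exp ((s $ j + h * axis i 1 $ j) / \<beta> R))) has_real_derivative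
      \<beta> R * ((\<Sum>j\<in>UNIV. exp (s $ j / \<beta> R) * (axis i 1 $ j / \<beta> R))
        / (\<Sum>j\<in>UNIV. exp (s $ j / \<beta> R)))) (at 0)"
    using assms pos by (auto intro!: derivative_eq_intros)
  moreover have "(\<Sum>j\<in>UNIV. exp (s $ j / \<beta> R) * (axis i 1 $ j / \<beta> R)) = exp (s $ i / \<beta> R) / \<beta> R"
    by (simp add: axis_def if_distrib [where f="\<lambda>x. _ * x"] if_distrib [where f="\<lambda>x. x / _"] cong: if_cong)
  ultimately show ?thesis
    using assms by (simp add: cost_def price_def softmax_def)
qed

text \<open>A state of the market is a pair \<open>(s, Etot)\<close> of shares sold and evidence present.
  \<open>trade_payoff\<close> is the payoff, if \<open>i\<close> is the outcome, of buying \<open>z\<close> and supplying \<open>E\<close>.\<close>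

definition trade_payoff ::
  "(real \<Rightarrow> real) \<Rightarrow> ('e set \<Rightarrow> real) \<Rightarrow> real ^ 'n \<Rightarrow> 'e set \<Rightarrow> real ^ 'n \<Rightarrow> 'e set \<Rightarrow> 'n \<Rightarrow> real" where
  "trade_payoff \<beta> r s Etot z E i =
     z $ i - (cost \<beta> (s + z) (r (Etot \<union> E)) - cost \<beta> s (r Etot))"

definition lmsr_profit ::
  "(real \<Rightarrow> real) \<Rightarrow> real ^ 'n \<Rightarrow> real \<Rightarrow> real ^ 'n \<Rightarrow> real \<Rightarrow> 'n \<Rightarrow> real" where
  "lmsr_profit \<beta> q R q' R' i = \<beta> R' * ln (q' $ i) - \<beta> R * ln (q $ i)"

definition expected :: "real ^ 'n \<Rightarrow> ('n \<Rightarrow> real) \<Rightarrow> real" where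
  "expected p f = (\<Sum>i\<in>UNIV. p $ i * f i)"

text \<open>\<open>bel\<close> maps the evidence submitted to the true belief it induces; it is constant under
  exogenous resolution.\<close>

definition incentive_compatible ::
  "real \<Rightarrow> (real \<Rightarrow> real) \<Rightarrow> ('e set \<Rightarrow> real) \<Rightarrow> real ^ 'n \<Rightarrow> 'e set \<Rightarrow> ('e set \<Rightarrow> real ^ 'n)
     \<Rightarrow> real ^ 'n \<Rightarrow> 'e set \<Rightarrow> bool" where
  "incentive_compatible \<epsilon> \<beta> r s Etot bel z E \<longleftrightarrow>
     (\<forall>z' E'. E' \<subseteq> E \<longrightarrow>
        expected (bel E') (trade_payoff \<beta> r s Etot z' E')
          \<le> expected (bel E) (trade_payoff \<beta> r s Etot z E) + \<epsilon>)"

text \<open>\<open>X j e\<close> says that piece \<open>e\<close> supports alternative \<open>j\<close> (outcome 1). The list \<open>xs\<close> holds the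
  outcome vectors of the pieces of evidence arriving after the trader, in order of arrival;
  if \<open>E\<close> is submitted, only the first \<open>K - card Etot - card E\<close> of them arrive before resolution.\<close>

definition final_theta ::
  "nat \<Rightarrow> ('n \<Rightarrow> 'e \<Rightarrow> bool) \<Rightarrow> 'e set \<Rightarrow> 'e set \<Rightarrow> ('n \<Rightarrow> bool) list \<Rightarrow> real ^ 'n" where
  "final_theta K X Etot E xs = (\<chi> j.
     (real (card {e \<in> Etot. X j e}) + real (card {e \<in> E. X j e})
        + real (length (filter (\<lambda>x. x j) (take (K - card Etot - card E) xs)))) / real K)"

definition endogenous_belief ::
  "real \<Rightarrow> nat \<Rightarrow> ('n \<Rightarrow> 'e \<Rightarrow> bool) \<Rightarrow> 'e set \<Rightarrow> ('n \<Rightarrow> bool) list pmf \<Rightarrow> 'e set \<Rightarrow> real ^ 'n" where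
  "endogenous_belief \<tau> K X Etot D E = (\<chi> j.
     measure_pmf.expectation D (\<lambda>xs. softmax \<tau> (final_theta K X Etot E xs) $ j))"

definition softmax_mixture :: "real \<Rightarrow> real ^ 'n \<Rightarrow> bool" where
  "softmax_mixture \<tau> q \<longleftrightarrow>
     (\<exists>\<mu> :: (real ^ 'n) measure. prob_space \<mu> \<and> sets \<mu> = sets borel \<and>
        (AE \<theta> in \<mu>. \<forall>i. 0 \<le> \<theta> $ i \<and> \<theta> $ i \<le> 1) \<and>
        (\<forall>j. q $ j = (\<integral>\<theta>. softmax \<tau> \<theta> $ j \<partial>\<mu>)))"

end

theory Submission
  imports Defs
begin

text \<open>With \<open>\<pi> = price \<beta> s R\<close> one has \<open>s\<^sub>i - cost \<beta> s R = \<beta> R ln \<pi>\<^sub>i\<close>, which is (i).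
  The expected payoff is thus a scaled log score, and by Gibbs' inequality the optimal price given a
  submitted set \<open>E'\<close> is the belief \<open>q'\<close> it induces, with value
  \<open>\<beta>' \<Sum> q' ln q' - \<beta>\<^sub>0 \<Sum> q' ln q\<^sub>0\<close>. Submitting more evidence lowers \<open>\<beta>'\<close>, which is favourable
  because \<open>\<Sum> q' ln q' \<le> 0\<close>; this settles exogenous resolution. Under endogenous resolution the
  submission also changes \<open>q'\<close>, but at temperature \<open>\<tau>\<close> every belief, and \<open>q\<^sub>0\<close>, has
  logarithms within \<open>1/\<tau>\<close> of those of the uniform distribution, so that the gain is at most
  \<open>4 \<beta>(0) / \<tau>\<close>.\<close>

section \<open>Expectations of logarithms and Gibbs' inequality\<close>

lemma expected_le_const:
  assumes "p \<in> prob_simplex" and "\<And>i. f i \<le> c"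
  shows "expected p f \<le> c"
proof -
  have "expected p f \<le> (\<Sum>i\<in>UNIV. p $ i * c)"
    unfolding expected_def using assms by (intro sum_mono mult_left_mono) (auto simp: prob_simplex_def)
  also have "\<dots> = c"
    using assms by (simp add: prob_simplex_def flip: sum_distrib_right)
  finally show ?thesis .
qed

lemma const_le_expected:
  assumes "p \<in> prob_simplex" and "\<And>i. c \<le> f i"
  shows "c \<le> expected p f"
  using expected_le_const[of p "\<lambda>i. - f i" "- c"] assms by (simp add: expected_def sum_negf)

text \<open>Apply \<open>ln x \<le> x - 1\<close> at the ratio \<open>q $ i / p $ i\<close>, weight
  by \<open>p $ i\<close> and sum: the right-hand side vanishes because both vectors total 1.
  Interiority keeps every ratio and logarithm meaningful.\<close>

lemma gibbs_inequality:
  assumes p: "p \<in> rel_interior prob_simplex" and q: "q \<in> rel_interior prob_simplex"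
  shows "expected p (\<lambda>i. ln (q $ i)) \<le> expected p (\<lambda>i. ln (p $ i))"
proof -
  have "p $ i * ln (q $ i) - p $ i * ln (p $ i) \<le> q $ i - p $ i" for i
  proof -
    have "0 < p $ i" "0 < q $ i"
      using p q by (auto simp: rel_interior_prob_simplex)
    moreover from this have "ln (q $ i / p $ i) \<le> q $ i / p $ i - 1"
      by (intro ln_le_minus_one) simp
    ultimately have "p $ i * (ln (q $ i) - ln (p $ i)) \<le> p $ i * (q $ i / p $ i - 1)"
      by (intro mult_left_mono) (simp_all add: ln_div)
    with \<open>0 < p $ i\<close> show ?thesis by (simp add: algebra_simps)
  qed
  then have "(\<Sum>i\<in>UNIV. p $ i * ln (q $ i) - p $ i * ln (p $ i)) \<le> (\<Sum>i\<in>UNIV. q $ i - p $ i)"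
    by (rule sum_mono)
  with p q show ?thesis
    by (simp add: expected_def sum_subtractf rel_interior_prob_simplex)
qed

text \<open>This is negative Shannon entropy; its sign decides in which direction a change of
  liquidity moves the value of an optimal report.\<close>

lemma expected_ln_self_nonpos:
  assumes "p \<in> rel_interior prob_simplex"
  shows "expected p (\<lambda>i. ln (p $ i)) \<le> 0"
proof (rule expected_le_const)
  show p: "p \<in> prob_simplex"
    using assms rel_interior_subset by blast
  show "ln (p $ i) \<le> 0" for i
  proof -
    have "p $ i \<le> (\<Sum>j\<in>UNIV. p $ j)"
      using p by (intro member_le_sum) (auto simp: prob_simplex_def)
    then show ?thesis
      using assms p by (simp add: rel_interior_prob_simplex)
  qed
qed

section \<open>Prices and the logarithmic form of the payoff\<close>

lemma softmax_in_rel_interior: "softmax \<tau> x \<in> rel_interior prob_simplex"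
proof -
  have "0 < (\<Sum>j\<in>UNIV. exp (x $ j / \<tau>))"
    by (intro sum_pos) auto
  then show ?thesis
    by (simp add: softmax_def rel_interior_prob_simplex flip: sum_divide_distrib)
qed

lemma ln_price:
  assumes "0 < \<beta> R"
  shows "\<beta> R * ln (price \<beta> s R $ i) = s $ i - cost \<beta> s R"
proof -
  have "0 < (\<Sum>j\<in>UNIV. exp (s $ j / \<beta> R))"
    by (intro sum_pos) auto
  with assms show ?thesis
    by (simp add: price_def softmax_def cost_def ln_div algebra_simps)
qed

lemma price_surj:
  assumes "0 < \<beta> R" and "q \<in> rel_interior prob_simplex"
  obtains z where "price \<beta> (s + z) R = q"
proof
  \<comment> \<open>The share vector aimed at has entries \<open>\<beta> R * ln (q $ i)\<close>:
    their scaled exponentials are the \<open>q $ i\<close>, which already sum to 1, so the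
    normaliser of the softmax is 1.\<close>
  have "exp (\<beta> R * ln (q $ i) / \<beta> R) = q $ i" for i
    using assms by (simp add: rel_interior_prob_simplex)
  then show "price \<beta> (s + (\<chi> i. \<beta> R * ln (q $ i) - s $ i)) R = q"
    using assms by (simp add: price_def softmax_def rel_interior_prob_simplex vec_eq_iff)
qed

text \<open>Subtracting \<open>ln_price\<close> before the trade from \<open>ln_price\<close> after
  it cancels \<open>s\<close> and leaves \<open>z\<close>. The identity holds outcome by outcome, so
  (i) follows for every distribution.\<close>

lemma trade_payoff_eq_lmsr_profit:
  assumes "0 < \<beta> (r Etot)" and "0 < \<beta> (r (Etot \<union> E))"
  shows "trade_payoff \<beta> r s Etot z E
    = lmsr_profit \<beta> (price \<beta> s (r Etot)) (r Etot) (price \<beta> (s + z) (r (Etot \<union> E))) (r (Etot \<union> E))"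
  using assms by (simp add: fun_eq_iff trade_payoff_def lmsr_profit_def ln_price)

lemma expected_lmsr_profit:
  "expected p (lmsr_profit \<beta> q R q' R')
    = \<beta> R' * expected p (\<lambda>i. ln (q' $ i)) - \<beta> R * expected p (\<lambda>i. ln (q $ i))"
  by (simp add: expected_def lmsr_profit_def sum_distrib_left right_diff_distrib sum_subtractf mult.left_commute)

section \<open>Liquidity along evidence sets, and incentive compatibility\<close>

lemma liquidity_evidence_pos:
  assumes "liquidity \<beta>" "evidence_quality r" "finite E"
  shows "0 < \<beta> (r E)"
  using assms by (simp add: liquidity_def evidence_quality_def)

lemma liquidity_evidence_antimono:
  assumes "liquidity \<beta>" "evidence_quality r" "finite E2" "E1 \<subseteq> E2"
  shows "\<beta> (r E2) \<le> \<beta> (r E1)"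
proof -
  have "finite E1" using assms finite_subset by blast
  then show ?thesis
    using assms by (auto simp: liquidity_def evidence_quality_def monotone_on_def)
qed

text \<open>A bound free of the evidence set, so that one temperature can later serve all market
  states.\<close>

lemma liquidity_evidence_le:
  assumes "liquidity \<beta>" "evidence_quality r" "finite E"
  shows "\<beta> (r E) \<le> \<beta> 0"
  using assms by (auto simp: liquidity_def evidence_quality_def monotone_on_def)

text \<open>Common core of both resolution modes: deviations in price and in liquidity are absorbed
  here, and \<open>gain\<close> is left to bound what the submission achieves by shifting the belief
  itself.\<close>

lemma incentive_compatible_truthful:
  fixes s :: "real ^ 'n"
  assumes \<beta>: "liquidity \<beta>" and r: "evidence_quality r" and fin: "finite Etot" "finite E"
    and bel: "\<And>E'. E' \<subseteq> E \<Longrightarrow> bel E' \<in> rel_interior prob_simplex"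
    and z: "price \<beta> (s + z) (r (Etot \<union> E)) = bel E"
    and gain: "\<And>E'. E' \<subseteq> E \<Longrightarrow>
      \<beta> (r (Etot \<union> E)) * (expected (bel E') (\<lambda>i. ln (bel E' $ i)) - expected (bel E) (\<lambda>i. ln (bel E $ i)))
      + \<beta> (r Etot) * (expected (bel E) (\<lambda>i. ln (price \<beta> s (r Etot) $ i))
          - expected (bel E') (\<lambda>i. ln (price \<beta> s (r Etot) $ i))) \<le> \<epsilon>"
  shows "incentive_compatible \<epsilon> \<beta> r s Etot bel z E"
  unfolding incentive_compatible_def
proof (intro allI impI)
  fix z' :: "real ^ 'n" and E' assume E': "E' \<subseteq> E"
  have fin': "finite E'" using E' fin finite_subset by blast
  let ?p = "bel E'"
  have pos: "0 < \<beta> (r Etot)" "0 < \<beta> (r (Etot \<union> E))" "0 < \<beta> (r (Etot \<union> E'))"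
    using liquidity_evidence_pos[OF \<beta> r] fin fin' by auto
  \<comment> \<open>For a fixed submission the term in the old price does not depend on
    \<open>z'\<close>; every reachable price is a softmax, hence interior, and Gibbs' inequality
    applies.\<close>
  have "\<beta> (r (Etot \<union> E')) * expected ?p (\<lambda>i. ln (price \<beta> (s + z') (r (Etot \<union> E')) $ i))
      \<le> \<beta> (r (Etot \<union> E')) * expected ?p (\<lambda>i. ln (?p $ i))"
    using pos bel[OF E'] softmax_in_rel_interior unfolding price_def
    by (intro mult_left_mono gibbs_inequality) auto
  \<comment> \<open>Liquidity is smaller at \<open>E\<close> than at \<open>E'\<close>, and the
    factor is nonpositive, so the product grows.\<close>
  also have "\<dots> \<le> \<beta> (r (Etot \<union> E)) * expected ?p (\<lambda>i. ln (?p $ i))"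
    using liquidity_evidence_antimono[OF \<beta> r, of "Etot \<union> E" "Etot \<union> E'"] fin E'
      expected_ln_self_nonpos[OF bel[OF E']]
    by (intro mult_right_mono_neg) auto
  finally show "expected (bel E') (trade_payoff \<beta> r s Etot z' E')
      \<le> expected (bel E) (trade_payoff \<beta> r s Etot z E) + \<epsilon>"
    using gain[OF E'] pos
    by (simp add: trade_payoff_eq_lmsr_profit expected_lmsr_profit z right_diff_distrib)
qed

section \<open>Softmax on the unit cube and its mixtures\<close>

lemma softmax_unit_cube_bounds:
  fixes \<theta> :: "real ^ 'n"
  assumes "0 < \<tau>" and \<theta>: "\<And>i. 0 \<le> \<theta> $ i \<and> \<theta> $ i \<le> 1"
  shows "softmax \<tau> \<theta> $ j \<in> {exp (- 1 / \<tau>) / CARD('n) .. exp (1 / \<tau>) / CARD('n)}"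
proof -
  let ?S = "\<Sum>i\<in>UNIV. exp (\<theta> $ i / \<tau>)" and ?n = "real CARD('n)"
  \<comment> \<open>All exponentials lie between 1 and \<open>exp (1 / \<tau>)\<close>, so the
    normaliser lies between \<open>?n\<close> and \<open>?n * exp (1 / \<tau>)\<close>.\<close>
  have e: "1 \<le> exp (\<theta> $ i / \<tau>)" "exp (\<theta> $ i / \<tau>) \<le> exp (1 / \<tau>)" for i
    using assms by (auto intro: divide_right_mono)
  have lower: "?n \<le> ?S"
    using sum_mono[of UNIV "\<lambda>_. 1::real" "\<lambda>i. exp (\<theta> $ i / \<tau>)"] e by simp
  have upper: "?S \<le> ?n * exp (1 / \<tau>)"
    using sum_mono[of UNIV "\<lambda>i. exp (\<theta> $ i / \<tau>)" "\<lambda>_. exp (1 / \<tau>)"] e by simp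
  have S: "0 < ?S" "0 < ?n"
    by (auto intro: sum_pos)
  have "exp (- 1 / \<tau>) / ?n = 1 / (?n * exp (1 / \<tau>))"
    by (simp add: exp_minus field_simps)
  also have "\<dots> \<le> exp (\<theta> $ j / \<tau>) / ?S"
    using e[of j] upper S by (intro frac_le) auto
  finally have "exp (- 1 / \<tau>) / ?n \<le> exp (\<theta> $ j / \<tau>) / ?S" .
  moreover have "exp (\<theta> $ j / \<tau>) / ?S \<le> exp (1 / \<tau>) / ?n"
    using e[of j] lower S by (intro frac_le) auto
  ultimately show ?thesis
    by (simp add: softmax_def)
qed

lemma borel_measurable_softmax [measurable]:
  "(\<lambda>\<theta>. softmax \<tau> \<theta> $ j) \<in> borel_measurable borel"
  \<comment> \<open>With quotients written through \<open>inverse\<close>, continuity leaves only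
    the nonvanishing of the normaliser to show.\<close>
  unfolding softmax_def vec_lambda_beta divide_inverse
proof (intro borel_measurable_continuous_onI continuous_intros)
  show "\<forall>\<theta>\<in>UNIV. (\<Sum>i\<in>UNIV. exp (\<theta> $ i * inverse \<tau>)) \<noteq> 0"
    using sum_pos[of UNIV "\<lambda>i. exp (_ $ i * inverse \<tau>)"] by (metis exp_gt_zero finite UNIV_not_empty less_irrefl)
qed

context prob_space
begin

lemma integrable_softmax:
  fixes f :: "'a \<Rightarrow> real ^ 'n"
  assumes [measurable]: "f \<in> borel_measurable M"
  shows "integrable M (\<lambda>x. softmax \<tau> (f x) $ j)"
proof (rule integrable_const_bound[where B = 1])
  have "norm (softmax \<tau> \<theta> $ j) \<le> 1" for \<theta> :: "real ^ 'n"
  proof -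
    have s: "softmax \<tau> \<theta> \<in> rel_interior prob_simplex" by (rule softmax_in_rel_interior)
    then have "softmax \<tau> \<theta> $ j \<le> (\<Sum>i\<in>UNIV. softmax \<tau> \<theta> $ i)"
      by (intro member_le_sum) (auto simp: rel_interior_prob_simplex intro: less_imp_le)
    with s show ?thesis
      by (simp add: rel_interior_prob_simplex abs_of_pos)
  qed
  then show "AE x in M. norm (softmax \<tau> (f x) $ j) \<le> 1" by simp
qed measurable

text \<open>Stated for a random vector \<open>f\<close> on any probability space, to cover both the
  trader's belief (\<open>f\<close> the final evidence averages) and the market price
  (\<open>f\<close> the identity under the mixing measure). The pointwise bounds survive
  integration.\<close>

lemma abs_ln_mixture_le:
  fixes f :: "'a \<Rightarrow> real ^ 'n"
  assumes f: "f \<in> borel_measurable M" and "0 < \<tau>"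
    and cube: "AE x in M. \<forall>i. 0 \<le> f x $ i \<and> f x $ i \<le> 1"
  shows "0 < (\<integral>x. softmax \<tau> (f x) $ j \<partial>M)"
    and "\<bar>ln (\<integral>x. softmax \<tau> (f x) $ j \<partial>M) + ln CARD('n)\<bar> \<le> 1 / \<tau>"
proof -
  let ?q = "\<integral>x. softmax \<tau> (f x) $ j \<partial>M" and ?n = "real CARD('n)"
  have bounds: "AE x in M. softmax \<tau> (f x) $ j \<in> {exp (- 1 / \<tau>) / ?n .. exp (1 / \<tau>) / ?n}"
    using cube by eventually_elim (use softmax_unit_cube_bounds[OF \<open>0 < \<tau>\<close>] in blast)
  have lower: "exp (- 1 / \<tau>) / ?n \<le> ?q"
    using bounds by (intro integral_ge_const integrable_softmax f) auto
  have upper: "?q \<le> exp (1 / \<tau>) / ?n"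
    using bounds by (intro integral_le_const integrable_softmax f) auto
  have "0 < exp (- 1 / \<tau>) / ?n" by simp
  with lower show pos: "0 < ?q" by linarith
  have "ln (exp (- 1 / \<tau>) / ?n) \<le> ln ?q" "ln ?q \<le> ln (exp (1 / \<tau>) / ?n)"
    using lower upper pos by (simp_all del: ln_exp)
  then show "\<bar>ln ?q + ln ?n\<bar> \<le> 1 / \<tau>"
    by (simp add: ln_div)
qed

end

section \<open>Endogenous beliefs and market prices near uniform\<close>

lemma final_theta_unit_cube:
  assumes "0 < K" "finite Etot" "finite E" "card Etot + card E \<le> K"
  shows "0 \<le> final_theta K X Etot E xs $ j \<and> final_theta K X Etot E xs $ j \<le> 1"
proof -
  have "card {e \<in> Etot. X j e} \<le> card Etot" "card {e \<in> E. X j e} \<le> card E"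
    using assms by (auto intro!: card_mono)
  moreover have "length (filter (\<lambda>x. x j) (take (K - card Etot - card E) xs)) \<le> K - card Etot - card E"
    by (rule order_trans[OF length_filter_le]) simp
  \<comment> \<open>As \<open>card Etot + card E \<le> K\<close>, the truncated subtraction is exact
    and the three bounds add up to \<open>K\<close>.\<close>
  ultimately have "card {e \<in> Etot. X j e} + card {e \<in> E. X j e}
      + length (filter (\<lambda>x. x j) (take (K - card Etot - card E) xs)) \<le> K"
    using assms by linarith
  then show ?thesis
    using \<open>0 < K\<close> by (simp add: final_theta_def flip: of_nat_add)
qed

lemma endogenous_belief_near_uniform:
  fixes X :: "'n::finite \<Rightarrow> 'e \<Rightarrow> bool"
  assumes "0 < \<tau>" "0 < K" "finite Etot" "finite E" "card Etot + card E \<le> K"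
  shows "endogenous_belief \<tau> K X Etot D E \<in> rel_interior prob_simplex"
    and "\<bar>ln (endogenous_belief \<tau> K X Etot D E $ j) + ln CARD('n)\<bar> \<le> 1 / \<tau>"
proof -
  let ?f = "final_theta K X Etot E"
  have f: "?f \<in> borel_measurable D" by simp
  have cube: "AE xs in D. \<forall>i. 0 \<le> ?f xs $ i \<and> ?f xs $ i \<le> 1"
    using final_theta_unit_cube[OF assms(2-5)] by blast
  note bounds = measure_pmf.abs_ln_mixture_le[OF f \<open>0 < \<tau>\<close> cube]
  show "\<bar>ln (endogenous_belief \<tau> K X Etot D E $ j) + ln CARD('n)\<bar> \<le> 1 / \<tau>"
    using bounds(2) by (simp add: endogenous_belief_def)
  have "(\<Sum>j\<in>UNIV. endogenous_belief \<tau> K X Etot D E $ j)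
      = (\<integral>xs. (\<Sum>j\<in>UNIV. softmax \<tau> (?f xs) $ j) \<partial>D)"
    by (simp add: endogenous_belief_def Bochner_Integration.integral_sum measure_pmf.integrable_softmax)
  also have "\<dots> = 1"
    using softmax_in_rel_interior[of \<tau> "?f _"] by (simp add: rel_interior_prob_simplex)
  finally show "endogenous_belief \<tau> K X Etot D E \<in> rel_interior prob_simplex"
    using bounds(1) by (simp add: rel_interior_prob_simplex endogenous_belief_def)
qed

lemma softmax_mixture_near_uniform:
  fixes q :: "real ^ 'n"
  assumes "softmax_mixture \<tau> q" "0 < \<tau>"
  shows "\<bar>ln (q $ j) + ln CARD('n)\<bar> \<le> 1 / \<tau>"
proof -
  obtain \<mu> :: "(real ^ 'n) measure" where \<mu>: "prob_space \<mu>" "sets \<mu> = sets borel"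
      "AE \<theta> in \<mu>. \<forall>i. 0 \<le> \<theta> $ i \<and> \<theta> $ i \<le> 1" "\<And>j. q $ j = (\<integral>\<theta>. softmax \<tau> \<theta> $ j \<partial>\<mu>)"
    using assms(1) unfolding softmax_mixture_def by blast
  \<comment> \<open>The mixing measure carries the Borel sets, so the identity serves as the random
    vector.\<close>
  have "(\<lambda>\<theta>. \<theta>) \<in> borel_measurable \<mu>"
    using measurable_ident_sets[OF \<mu>(2)] by simp
  from prob_space.abs_ln_mixture_le(2)[OF \<mu>(1) this \<open>0 < \<tau>\<close> \<mu>(3)] show ?thesis
    by (simp add: \<mu>(4))
qed

lemma expected_near_const:
  assumes "p \<in> rel_interior prob_simplex" and "\<And>i. \<bar>f i + c\<bar> \<le> d"
  shows "\<bar>expected p f + c\<bar> \<le> d"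
proof -
  have p: "p \<in> prob_simplex" using assms(1) rel_interior_subset by blast
  have "f i \<le> d - c" "- d - c \<le> f i" for i
    using assms(2)[of i] by linarith+
  from expected_le_const[OF p, of f, OF this(1)] const_le_expected[OF p, of _ f, OF this(2)] show ?thesis
    by linarith
qed

text \<open>Each difference in \<open>gain\<close> compares two numbers within
  \<open>\<delta>\<close> of \<open>- ln CARD('n)\<close>, hence is at most
  \<open>2 * \<delta>\<close>; both weights are at most \<open>\<beta> 0\<close>.\<close>

lemma incentive_compatible_near_uniform:
  fixes s :: "real ^ 'n"
  assumes \<beta>: "liquidity \<beta>" and r: "evidence_quality r" and fin: "finite Etot" "finite E"
    and bel: "\<And>E'. E' \<subseteq> E \<Longrightarrow> bel E' \<in> rel_interior prob_simplex"
    and bel_near: "\<And>E' i. E' \<subseteq> E \<Longrightarrow> \<bar>ln (bel E' $ i) + ln CARD('n)\<bar> \<le> \<delta>"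
    and price_near: "\<And>i. \<bar>ln (price \<beta> s (r Etot) $ i) + ln CARD('n)\<bar> \<le> \<delta>"
    and z: "price \<beta> (s + z) (r (Etot \<union> E)) = bel E"
  shows "incentive_compatible (4 * \<beta> 0 * \<delta>) \<beta> r s Etot bel z E"
proof (rule incentive_compatible_truthful[where bel = bel, OF \<beta> r fin bel z])
  fix E' assume E': "E' \<subseteq> E"
  have near: "\<bar>expected (bel F) (\<lambda>i. ln (bel F $ i)) + ln CARD('n)\<bar> \<le> \<delta>"
      "\<bar>expected (bel F) (\<lambda>i. ln (price \<beta> s (r Etot) $ i)) + ln CARD('n)\<bar> \<le> \<delta>" if "F \<subseteq> E" for F
    using that by (auto intro!: expected_near_const bel bel_near price_near)
  have "0 \<le> \<delta>"
    using price_near[of undefined] by linarith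
  \<comment> \<open>Here \<open>x\<close> may be negative, so it is replaced by
    \<open>2 * \<delta>\<close> before the liquidity is enlarged.\<close>
  have scale: "\<beta> (r F) * x \<le> \<beta> 0 * (2 * \<delta>)" if "finite F" "x \<le> 2 * \<delta>" for F x
  proof -
    have "\<beta> (r F) * x \<le> \<beta> (r F) * (2 * \<delta>)"
      using liquidity_evidence_pos[OF \<beta> r] that by (intro mult_left_mono) (auto intro: less_imp_le)
    also have "\<dots> \<le> \<beta> 0 * (2 * \<delta>)"
      using liquidity_evidence_le[OF \<beta> r] that \<open>0 \<le> \<delta>\<close> by (intro mult_right_mono) auto
    finally show ?thesis .
  qed
  have "\<beta> (r (Etot \<union> E)) * (expected (bel E') (\<lambda>i. ln (bel E' $ i)) - expected (bel E) (\<lambda>i. ln (bel E $ i)))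
      \<le> \<beta> 0 * (2 * \<delta>)"
    using near(1)[OF E'] near(1)[OF order_refl] fin by (intro scale) auto
  moreover have "\<beta> (r Etot) * (expected (bel E) (\<lambda>i. ln (price \<beta> s (r Etot) $ i))
      - expected (bel E') (\<lambda>i. ln (price \<beta> s (r Etot) $ i))) \<le> \<beta> 0 * (2 * \<delta>)"
    using near(2)[OF E'] near(2)[OF order_refl] fin by (intro scale) auto
  ultimately show "\<beta> (r (Etot \<union> E)) * (expected (bel E') (\<lambda>i. ln (bel E' $ i)) - expected (bel E) (\<lambda>i. ln (bel E $ i)))
      + \<beta> (r Etot) * (expected (bel E) (\<lambda>i. ln (price \<beta> s (r Etot) $ i))
          - expected (bel E') (\<lambda>i. ln (price \<beta> s (r Etot) $ i))) \<le> 4 * \<beta> 0 * \<delta>"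
    by linarith
qed

section \<open>Assembly of the cases and choice of the temperature\<close>

theorem theorem3:
  fixes \<beta> :: "real \<Rightarrow> real" and r :: "'e set \<Rightarrow> real"
  assumes "liquidity \<beta>" and "evidence_quality r"
  shows
    "\<comment> \<open>(i)\<close>
     (\<forall>(s :: real ^ 'n) Etot z E p.
        (\<forall>i. 0 \<le> s $ i) \<longrightarrow> finite Etot \<longrightarrow> finite E \<longrightarrow> p \<in> prob_simplex \<longrightarrow>
        expected p (trade_payoff \<beta> r s Etot z E)
          = expected p (lmsr_profit \<beta> (price \<beta> s (r Etot)) (r Etot)
                          (price \<beta> (s + z) (r (Etot \<union> E))) (r (Etot \<union> E))))
    \<and>
    \<comment> \<open>(ii), exogenous resolution\<close>
     (\<forall>(s :: real ^ 'n) Etot E q.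
        (\<forall>i. 0 \<le> s $ i) \<longrightarrow> finite Etot \<longrightarrow> finite E \<longrightarrow> q \<in> rel_interior prob_simplex \<longrightarrow>
        (\<exists>z. price \<beta> (s + z) (r (Etot \<union> E)) = q \<and>
             incentive_compatible 0 \<beta> r s Etot (\<lambda>_. q) z E))
    \<and>
    \<comment> \<open>(ii), endogenous resolution\<close>
     (\<forall>K>0. \<forall>\<epsilon>>0. \<exists>\<tau>>0.
        \<forall>(X :: 'n \<Rightarrow> 'e \<Rightarrow> bool) (s :: real ^ 'n) Etot E D.
          (\<forall>i. 0 \<le> s $ i) \<longrightarrow> finite Etot \<longrightarrow> finite E \<longrightarrow> card Etot + card E \<le> K \<longrightarrow>
          set_pmf D \<subseteq> {xs. length xs = K - card Etot} \<longrightarrow>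
          softmax_mixture \<tau> (price \<beta> s (r Etot)) \<longrightarrow>
          (\<exists>z. price \<beta> (s + z) (r (Etot \<union> E)) = endogenous_belief \<tau> K X Etot D E \<and>
               incentive_compatible \<epsilon> \<beta> r s Etot (endogenous_belief \<tau> K X Etot D) z E))"
proof (intro conjI)
  note pos = liquidity_evidence_pos[OF assms]
  show "\<forall>(s :: real ^ 'n) Etot z E p.
      (\<forall>i. 0 \<le> s $ i) \<longrightarrow> finite Etot \<longrightarrow> finite E \<longrightarrow> p \<in> prob_simplex \<longrightarrow>
      expected p (trade_payoff \<beta> r s Etot z E)
        = expected p (lmsr_profit \<beta> (price \<beta> s (r Etot)) (r Etot)
                        (price \<beta> (s + z) (r (Etot \<union> E))) (r (Etot \<union> E)))"
    using pos by (simp add: trade_payoff_eq_lmsr_profit)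
  show "\<forall>(s :: real ^ 'n) Etot E q.
      (\<forall>i. 0 \<le> s $ i) \<longrightarrow> finite Etot \<longrightarrow> finite E \<longrightarrow> q \<in> rel_interior prob_simplex \<longrightarrow>
      (\<exists>z. price \<beta> (s + z) (r (Etot \<union> E)) = q \<and>
           incentive_compatible 0 \<beta> r s Etot (\<lambda>_. q) z E)"
  proof (intro allI impI)
    fix s :: "real ^ 'n" and Etot E :: "'e set" and q :: "real ^ 'n"
    assume *: "finite Etot" "finite E" "q \<in> rel_interior prob_simplex"
    obtain z where "price \<beta> (s + z) (r (Etot \<union> E)) = q"
      using price_surj[of \<beta> "r (Etot \<union> E)" q s] pos * by blast
    with * show "\<exists>z. price \<beta> (s + z) (r (Etot \<union> E)) = q \<and>
        incentive_compatible 0 \<beta> r s Etot (\<lambda>_. q) z E"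
      \<comment> \<open>For a constant belief both differences in \<open>gain\<close> are
        zero.\<close>
      by (intro exI[of _ z] conjI incentive_compatible_truthful assms) simp_all
  qed
  show "\<forall>K>0. \<forall>\<epsilon>>0. \<exists>\<tau>>0.
      \<forall>(X :: 'n \<Rightarrow> 'e \<Rightarrow> bool) (s :: real ^ 'n) Etot E D.
        (\<forall>i. 0 \<le> s $ i) \<longrightarrow> finite Etot \<longrightarrow> finite E \<longrightarrow> card Etot + card E \<le> K \<longrightarrow>
        set_pmf D \<subseteq> {xs. length xs = K - card Etot} \<longrightarrow>
        softmax_mixture \<tau> (price \<beta> s (r Etot)) \<longrightarrow>
        (\<exists>z. price \<beta> (s + z) (r (Etot \<union> E)) = endogenous_belief \<tau> K X Etot D E \<and>
             incentive_compatible \<epsilon> \<beta> r s Etot (endogenous_belief \<tau> K X Etot D) z E)"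
  proof (intro allI impI)
    fix K :: nat and \<epsilon> :: real
    assume "0 < K" "0 < \<epsilon>"
    \<comment> \<open>Chosen so that the error with \<open>\<delta> = 1 / \<tau>\<close> is exactly
      \<open>\<epsilon>\<close>; it depends on neither the state nor the evidence, as the order of
      quantifiers requires.\<close>
    define \<tau> where "\<tau> = 4 * \<beta> 0 / \<epsilon>"
    have "0 < \<beta> 0"
      using assms(1) by (simp add: liquidity_def)
    with \<open>0 < \<epsilon>\<close> have \<tau>: "0 < \<tau>" "4 * \<beta> 0 * (1 / \<tau>) = \<epsilon>"
      by (simp_all add: \<tau>_def)
    show "\<exists>\<tau>>0. \<forall>(X :: 'n \<Rightarrow> 'e \<Rightarrow> bool) (s :: real ^ 'n) Etot E D.
        (\<forall>i. 0 \<le> s $ i) \<longrightarrow> finite Etot \<longrightarrow> finite E \<longrightarrow> card Etot + card E \<le> K \<longrightarrow>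
        set_pmf D \<subseteq> {xs. length xs = K - card Etot} \<longrightarrow>
        softmax_mixture \<tau> (price \<beta> s (r Etot)) \<longrightarrow>
        (\<exists>z. price \<beta> (s + z) (r (Etot \<union> E)) = endogenous_belief \<tau> K X Etot D E \<and>
             incentive_compatible \<epsilon> \<beta> r s Etot (endogenous_belief \<tau> K X Etot D) z E)"
    proof (intro exI[of _ \<tau>] conjI allI impI \<tau>(1))
      fix X :: "'n \<Rightarrow> 'e \<Rightarrow> bool" and s :: "real ^ 'n" and Etot E :: "'e set" and D
      assume fin: "finite Etot" "finite E" and card: "card Etot + card E \<le> K"
        and mix: "softmax_mixture \<tau> (price \<beta> s (r Etot))"
      let ?bel = "endogenous_belief \<tau> K X Etot D"
      \<comment> \<open>A deviation submits a subset of \<open>E\<close>, so it respects the budget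
        \<open>K\<close> too and its belief is equally close to uniform.\<close>
      have sub: "finite E'" "card Etot + card E' \<le> K" if "E' \<subseteq> E" for E'
        using finite_subset[OF that fin(2)] card_mono[OF fin(2) that] card by auto
      note bel = endogenous_belief_near_uniform[OF \<tau>(1) \<open>0 < K\<close> fin(1) sub]
      obtain z where z: "price \<beta> (s + z) (r (Etot \<union> E)) = ?bel E"
        using price_surj[of \<beta> "r (Etot \<union> E)" "?bel E" s] pos bel(1) fin by blast
      have "incentive_compatible (4 * \<beta> 0 * (1 / \<tau>)) \<beta> r s Etot ?bel z E"
        using assms fin z
        by (intro incentive_compatible_near_uniform bel softmax_mixture_near_uniform[OF mix \<tau>(1)])
      with z \<tau>(2) show "\<exists>z. price \<beta> (s + z) (r (Etot \<union> E)) = ?bel E \<and>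
          incentive_compatible \<epsilon> \<beta> r s Etot ?bel z E"
        by auto
    qed
  qed
qed

end
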